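(* Let $n\ge1$ and let $\zeta:\Pi(n)\to\Xi(n)$ be the map sending the class of $(g_1,\dots,g_n)$ to its spectral form $Q(\lambda)=\det\bigl(\sum_j\lambda_jg_j\bigr)$. Then: a) The map $\zeta:\Pi(n)\to\Xi(n)$ is surjective. b) For $Q\in\Xi(n)$, the preimage $\zeta^{-1}(Q)$ consists of exactly two points if $\operatorname{rk}Q=4$, and of exactly one point if $\operatorname{rk}Q\le3$. c) Moreover, for $(g_1,\dots,g_n)\in G(n)$ with spectral form $Q$, one has $\operatorname{rk}Q\le3$ if and only if $(g_1^t,\dots,g_n^t)$ and $(g_1,\dots,g_n)$ represent the same point of $\Pi(n)$, where $g^t$ denotes the transposed matrix.
   Context: $G(n)=\mathrm{SU}(2)^n$, and $K(n)\subset G(n)$ is the diagonal subgroup $\{(h,\dots,h):h\in\mathrm{SU}(2)\}$. $\Pi(n)=K(n)\backslash G(n)/K(n)$ is the set of $n$-tuples $(g_1,\dots,g_n)\in G(n)$ modulo $(g_1,\dots,g_n)\sim(hg_1q,\dots,hg_nq)$ for $h,q\in\mathrm{SU}(2)$. The spectral form $\det(\sum_j\lambda_jg_j)$ depends only on the class in $\Pi(n)$. $\Xi(n)$ denotes the set of all real quadratic forms $Q(\lambda)=\sum_{i,j}s_{ij}\lambda_i\lambda_j$ ($s_{ij}=s_{ji}$) on $\mathbb R^n$ that are positive semidefinite, have rank at most $4$, and satisfy $s_{jj}=1$ for all $j$; every spectral form belongs to $\Xi(n)$. *)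

theory Defs
  imports "HOL-Analysis.Analysis"
begin

definition conj_transpose :: "complex^'n^'m \<Rightarrow> complex^'m^'n" where
  "conj_transpose A = (\<chi> i j. cnj (A $ j $ i))"

definition SU2 :: "(complex^2^2) set" where
  "SU2 = {A. conj_transpose A ** A = mat 1 \<and> A ** conj_transpose A = mat 1 \<and> det A = 1}"

text \<open>An \<open>n\<close>-tuple is a function on a finite index type \<open>'n\<close>; since types are nonempty,
  \<open>n = CARD('n)\<close> ranges over all \<open>n \<ge> 1\<close>.\<close>

definition G :: "('n::finite \<Rightarrow> complex^2^2) set" where
  "G = {g. \<forall>j. g j \<in> SU2}"

definition dc_rel :: "(('n::finite \<Rightarrow> complex^2^2) \<times> ('n \<Rightarrow> complex^2^2)) set" where
  "dc_rel = {(g, g'). g \<in> G \<and> g' \<in> G \<and>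
     (\<exists>h\<in>SU2. \<exists>q\<in>SU2. \<forall>j. g' j = h ** g j ** q)}"

definition dc_class :: "('n::finite \<Rightarrow> complex^2^2) \<Rightarrow> ('n \<Rightarrow> complex^2^2) set" where
  "dc_class g = dc_rel `` {g}"

definition Pi_dc :: "('n::finite \<Rightarrow> complex^2^2) set set" where
  "Pi_dc = G // dc_rel"

definition quad_form :: "real^'n^'n \<Rightarrow> real^'n \<Rightarrow> real" where
  "quad_form S l = (\<Sum>i\<in>UNIV. \<Sum>j\<in>UNIV. S $ i $ j * l $ i * l $ j)"

text \<open>The rank of a quadratic form is the rank of its symmetric coefficient matrix, which
  is unique by \<open>form_matrix_quad_form\<close> below.\<close>

definition form_matrix :: "(real^'n \<Rightarrow> real) \<Rightarrow> real^'n^'n" where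
  "form_matrix Q = (THE S. transpose S = S \<and> Q = quad_form S)"

definition form_rank :: "(real^'n \<Rightarrow> real) \<Rightarrow> nat" where
  "form_rank Q = rank (form_matrix Q)"

definition Xi :: "(real^'n \<Rightarrow> real) set" where
  "Xi = {Q. \<exists>S. transpose S = S \<and> Q = quad_form S \<and>
     (\<forall>l. 0 \<le> Q l) \<and> form_rank Q \<le> 4 \<and> (\<forall>j. S $ j $ j = 1)}"

text \<open>For tuples in \<open>G\<close> the determinant is real (\<open>of_real_spectral_form\<close> below), so taking
  the real part only changes its type.\<close>

definition spectral_form :: "('n::finite \<Rightarrow> complex^2^2) \<Rightarrow> real^'n \<Rightarrow> real" where
  "spectral_form g l = Re (det (\<Sum>j\<in>UNIV. (l $ j) *\<^sub>R g j))"

text \<open>The spectral form is constant on classes, so the image below is a singleton;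
  see \<open>zeta_dc_class\<close>.\<close>

definition zeta :: "('n::finite \<Rightarrow> complex^2^2) set \<Rightarrow> (real^'n \<Rightarrow> real)" where
  "zeta p = the_elem (spectral_form ` p)"

lemma quad_form_axis:
  fixes S :: "real^'n^'n"
  assumes "transpose S = S"
  shows "S $ a $ b = (quad_form S (axis a 1 + axis b 1) - quad_form S (axis a 1)
           - quad_form S (axis b 1)) / 2"
proof -
  have ax: "(\<Sum>j\<in>UNIV. f j * axis k 1 $ j) = f k" for f :: "'n \<Rightarrow> real" and k
    by (simp add: axis_def if_distrib cong: if_cong)
  define B where "B = (\<lambda>(x::real^'n) y. \<Sum>i\<in>UNIV. \<Sum>j\<in>UNIV. S $ i $ j * x $ i * y $ j)"
  have Bax: "B (axis a 1) (axis b 1) = S $ a $ b" for a b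
  proof -
    have "B (axis a 1) (axis b 1) = (\<Sum>i\<in>UNIV. S $ i $ b * axis a 1 $ i)"
      unfolding B_def by (intro sum.cong refl) (rule ax)
    also have "\<dots> = S $ a $ b" by (rule ax)
    finally show ?thesis .
  qed
  have exp: "quad_form S (x + y) = quad_form S x + B x y + B y x + quad_form S y" for x y
    by (simp add: quad_form_def B_def algebra_simps sum.distrib)
  have "S $ b $ a = S $ a $ b"
    using assms by (metis transpose_def vec_lambda_beta)
  then show ?thesis
    unfolding exp by (simp add: Bax)
qed

lemma form_matrix_quad_form:
  fixes S :: "real^'n^'n"
  assumes "transpose S = S"
  shows "form_matrix (quad_form S) = S"
  unfolding form_matrix_def
proof (rule the_equality)
  show "transpose S = S \<and> quad_form S = quad_form S" using assms by simp
next
  fix T :: "real^'n^'n"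
  assume "transpose T = T \<and> quad_form S = quad_form T"
  then have T: "transpose T = T" and eq: "quad_form S = quad_form T" by auto
  have "T $ a $ b = S $ a $ b" for a b
    by (simp only: quad_form_axis[OF T] quad_form_axis[OF assms] eq)
  then show "T = S" by (simp add: vec_eq_iff)
qed

lemma SU2_entries:
  assumes "A \<in> SU2"
  shows "A $ 2 $ 2 = cnj (A $ 1 $ 1)" "A $ 2 $ 1 = - cnj (A $ 1 $ 2)"
proof -
  let ?a = "A $ 1 $ 1" and ?b = "A $ 1 $ 2" and ?c = "A $ 2 $ 1" and ?d = "A $ 2 $ 2"
  have m: "A ** conj_transpose A = mat 1" and dt: "?a * ?d - ?b * ?c = 1"
    using assms by (auto simp: SU2_def det_2)
  have e: "(A ** conj_transpose A) $ i $ j = A $ i $ 1 * cnj (A $ j $ 1) + A $ i $ 2 * cnj (A $ j $ 2)" for i j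
    by (simp add: matrix_matrix_mult_def conj_transpose_def sum_2)
  have 1: "?a * cnj ?a + ?b * cnj ?b = 1"
    using e[of 1 1] m by (simp add: mat_def)
  have 2: "?c * cnj ?a + ?d * cnj ?b = 0"
    using e[of 2 1] m by (simp add: mat_def)
  have "?d = ?d * (?a * cnj ?a + ?b * cnj ?b)" using 1 by simp
  also have "\<dots> = cnj ?a * (?a * ?d - ?b * ?c) + ?b * (?c * cnj ?a + ?d * cnj ?b)"
    by (simp add: algebra_simps)
  finally show "?d = cnj ?a" using 2 dt by simp
  have "?c = ?c * (?a * cnj ?a + ?b * cnj ?b)" using 1 by simp
  also have "\<dots> = ?a * (?c * cnj ?a + ?d * cnj ?b) - cnj ?b * (?a * ?d - ?b * ?c)"
    by (simp add: algebra_simps)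
  finally show "?c = - cnj ?b" using 2 dt by simp
qed

lemma of_real_spectral_form:
  assumes "g \<in> G"
  shows "complex_of_real (spectral_form g l) = det (\<Sum>j\<in>UNIV. (l $ j) *\<^sub>R g j)"
proof -
  let ?M = "\<Sum>j\<in>UNIV. (l $ j) *\<^sub>R g j"
  have "?M $ 2 $ 2 = cnj (?M $ 1 $ 1)" "?M $ 2 $ 1 = - cnj (?M $ 1 $ 2)"
    using assms by (simp_all add: G_def SU2_entries sum_negf)
  then have "det ?M = ?M $ 1 $ 1 * cnj (?M $ 1 $ 1) + ?M $ 1 $ 2 * cnj (?M $ 1 $ 2)"
    by (simp add: det_2)
  then have "Im (det ?M) = 0" by (simp only: complex_In_mult_cnj_zero plus_complex.sel add_0_left)
  then show ?thesis
    by (simp add: spectral_form_def complex_eq_iff)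
qed

lemma zeta_dc_class:
  assumes "g \<in> G"
  shows "zeta (dc_class g) = spectral_form g"
proof -
  have inv: "spectral_form g' = spectral_form g" if mem: "g' \<in> dc_class g" for g'
  proof
    fix l
    obtain h q where hq: "h \<in> SU2" "q \<in> SU2" and g': "\<And>j. g' j = h ** g j ** q"
      using mem unfolding dc_class_def dc_rel_def by blast
    have lin: "linear (\<lambda>X. h ** X ** q)"
      by (rule linearI)
        (simp_all add: vec_eq_iff matrix_matrix_mult_def sum_2 distrib_left distrib_right
          scaleR_add_right)
    have "(\<Sum>j\<in>UNIV. (l $ j) *\<^sub>R g' j) = h ** (\<Sum>j\<in>UNIV. (l $ j) *\<^sub>R g j) ** q"
      by (simp only: g' linear_sum[OF lin] linear_scale[OF lin])
    moreover have "det h = 1" "det q = 1"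
      using hq by (simp_all add: SU2_def)
    ultimately show "spectral_form g' l = spectral_form g l"
      by (simp only: spectral_form_def det_mul mult_1_left mult_1_right)
  qed
  have cj: "conj_transpose (mat 1 :: complex^2^2) = mat 1"
    by (simp add: conj_transpose_def mat_def vec_eq_iff)
  have "mat 1 \<in> SU2"
    by (simp add: SU2_def cj)
  moreover have "\<forall>j. g j = mat 1 ** g j ** mat 1"
    by simp
  ultimately have mem: "g \<in> dc_class g"
    using assms unfolding dc_class_def dc_rel_def by blast
  have "spectral_form ` dc_class g = {spectral_form g}"
  proof (intro equalityI subsetI)
    fix f assume "f \<in> spectral_form ` dc_class g"
    then show "f \<in> {spectral_form g}" by (elim imageE) (simp only: inv singleton_iff)
  next
    fix f assume "f \<in> {spectral_form g}"
    then show "f \<in> spectral_form ` dc_class g" using mem by blast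
  qed
  then show ?thesis by (simp add: zeta_def)
qed

end

(* Identifying SU(2) with the unit sphere of the quaternions R^4, the determinant becomes the
   squared norm, so the spectral form of g is the quadratic form of the Gram matrix of the g_j and
   its rank is the dimension of their span; this gives surjectivity. Two tuples with the same Gram
   matrix differ by a product of hyperplane reflections. The reflection in u is
   x |-> -u x^* u, and x^* is conjugate to the transpose x^t, so such a product is
   x |-> h x q or x |-> h x^t q: every fibre is {[g], [g^t]}. If the g_j do not span, the
   reflection fixing their span identifies [g] with [g^t]; if they span, [g] = [g^t] would
   make x |-> x^t of the form x |-> h x q on all quaternions, which is impossible. *)
theory Submission
  imports Defs
begin

section \<open>Gram matrices\<close>

lemma quad_form_eq_inner: "quad_form S l = l \<bullet> (S *v l)"
  by (simp add: quad_form_def inner_vec_def matrix_vector_mult_def sum_distrib_left ac_simps)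

lemma inner_symmetric_matrix:
  fixes S :: "real^'n^'n"
  assumes "transpose S = S"
  shows "(S *v x) \<bullet> y = x \<bullet> (S *v y)"
  by (metis assms dot_lmul_matrix transpose_matrix_vector)

text \<open>If \<open>transpose A ** A\<close> kills z, then the squared norm of
  \<open>A *v z\<close> is 0. So the product is injective on the row space of \<open>A\<close>,
  which meets the kernel of \<open>A\<close> only in 0.\<close>

lemma rank_transpose_mult_self:
  fixes A :: "real^'n^'m"
  shows "rank (transpose A ** A) = rank A"
proof (rule antisym)
  let ?S = "transpose A ** A"
  show "rank ?S \<le> rank A" by (rule rank_mul_le_right)
  have "inj_on (\<lambda>x. ?S *v x) (span (rows A))"
  proof (rule inj_onI)
    fix x y assume xy: "x \<in> span (rows A)" "y \<in> span (rows A)" and eq: "?S *v x = ?S *v y"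
    have "(A *v (x - y)) \<bullet> (A *v (x - y)) = (x - y) \<bullet> (?S *v (x - y))"
      by (metis dot_lmul_matrix inner_commute matrix_vector_mul_assoc transpose_matrix_vector)
    also have "\<dots> = 0" using eq by (simp add: matrix_vector_mult_diff_distrib)
    finally have "A *v (x - y) = 0" by simp
    moreover have "x - y \<in> span (rows A)" using xy by (rule span_diff)
    ultimately show "x = y" using nullspace_inter_rowspace[of A "x - y"] by simp
  qed
  then have "dim ((\<lambda>x. ?S *v x) ` span (rows A)) = dim (span (rows A))"
    by (intro dim_image_eq) (auto simp only: matrix_vector_mul_linear span_span)
  then show "rank A \<le> rank ?S"
    unfolding rank_dim_range[of ?S]
    by (metis dim_span dim_subset image_mono row_rank_def subset_UNIV)
qed

text \<open>Induction on the index set: splitting off the rank-one form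
  \<open>(S x) (S x)\<^sup>T / (x \<bullet> S x)\<close> leaves a positive semidefinite form of smaller rank.\<close>
lemma psd_sum_of_rank_one:
  fixes S :: "real^'n^'n" and M :: "'m set"
  assumes "finite M" "transpose S = S" "\<And>l. 0 \<le> quad_form S l" "rank S \<le> card M"
  shows "\<exists>a :: 'm \<Rightarrow> real^'n. \<forall>i j. S $ i $ j = (\<Sum>m\<in>M. a m $ i * a m $ j)"
  using assms
proof (induction M arbitrary: S rule: finite_induct)
  case empty
  then have "S = 0" by (simp add: rank_eq_0)
  then show ?case by simp
next
  case (insert m M)
  note sym = insert.prems(1) and psd = insert.prems(2)
  show ?case
  proof (cases "\<exists>x. quad_form S x \<noteq> 0")
    case False
    \<comment> \<open>By polarization, a form that vanishes identically has zero matrix.\<close>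
    then have "S $ i $ j = 0" for i j
      using quad_form_axis[OF sym, of i j] by simp
    then show ?thesis by (intro exI[of _ "\<lambda>_. 0"]) simp
  next
    case True
    then obtain x where x: "quad_form S x > 0" using psd by (metis less_eq_real_def)
    define c where "c = quad_form S x"
    define y where "y = S *v x"
    define T where "T = (\<chi> i j. S $ i $ j - y $ i * y $ j / c)"
    have c: "c > 0" "x \<bullet> y = c" using x by (auto simp: c_def y_def quad_form_eq_inner)
    have symT: "transpose T = T"
    proof -
      have "S $ i $ j = S $ j $ i" for i j using sym by (metis transpose_def vec_lambda_beta)
      then show ?thesis by (simp add: T_def transpose_def vec_eq_iff)
    qed
    have Tv: "T *v l = S *v l - ((y \<bullet> l) / c) *\<^sub>R y" for l
      by (simp add: T_def vec_eq_iff matrix_vector_mult_def inner_vec_def left_diff_distrib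
          right_diff_distrib sum_subtractf sum_distrib_left sum_distrib_right sum_divide_distrib
          ac_simps)
    have Sy: "(S *v l) \<bullet> x = l \<bullet> y" for l
      using inner_symmetric_matrix[OF sym, of l x] by (simp add: y_def)
    have psdT: "0 \<le> quad_form T l" for l
    proof -
      \<comment> \<open>This \<open>t\<close> minimizes
        \<open>quad_form S (l - t *\<^sub>R x)\<close>. The minimum is the value of \<open>T\<close>
        at \<open>l\<close>, which is therefore nonnegative.\<close>
      define t where "t = (y \<bullet> l) / c"
      have "quad_form T l = quad_form S l - (y \<bullet> l)\<^sup>2 / c"
        unfolding quad_form_eq_inner Tv
        by (simp add: inner_diff_right power2_eq_square inner_commute)
      also have "\<dots> = quad_form S (l - t *\<^sub>R x)"
      proof -
        have "quad_form S (l - t *\<^sub>R x) = (l - t *\<^sub>R x) \<bullet> (S *v l - t *\<^sub>R y)"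
          by (simp add: quad_form_eq_inner y_def matrix_vector_mult_diff_distrib
              matrix_vector_mult_scaleR)
        also have "\<dots> = quad_form S l - 2 * t * (y \<bullet> l) + t * t * c"
          using c(2) Sy[of l]
          by (simp add: quad_form_eq_inner inner_diff_left inner_diff_right inner_commute
              algebra_simps)
        also have "\<dots> = quad_form S l - (y \<bullet> l)\<^sup>2 / c"
          using c(1) by (simp add: t_def field_simps power2_eq_square)
        finally show ?thesis by simp
      qed
      finally show ?thesis using psd by simp
    qed
    have "rank T < rank S"
    proof -
      let ?RT = "range (\<lambda>l. T *v l)" and ?RS = "range (\<lambda>l. S *v l)"
      have "T *v l = S *v (l - ((y \<bullet> l) / c) *\<^sub>R x)" for l
        by (simp add: Tv y_def matrix_vector_mult_diff_distrib matrix_vector_mult_scaleR)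
      then have sub: "?RT \<subseteq> ?RS" by auto
      \<comment> \<open>The range of \<open>T\<close> lies in that of \<open>S\<close> and is
        orthogonal to \<open>x\<close>, whereas \<open>y = S *v x\<close> pairs with
        \<open>x\<close> to \<open>c > 0\<close>. Hence the inclusion is strict and the rank
        drops.\<close>
      have "x \<bullet> (T *v l) = 0" for l
        using c Sy[of l] by (simp add: Tv inner_diff_right inner_commute)
      then have "y \<notin> ?RT" using c by force
      moreover have "y \<in> ?RS" by (simp add: y_def)
      moreover have "subspace ?RT" "subspace ?RS"
        by (auto intro!: linear_subspace_image matrix_vector_mul_linear)
      ultimately show ?thesis
        unfolding rank_dim_range using sub
        by (intro dim_psubset) (metis psubsetI span_eq_iff)
    qed
    with insert have "rank T \<le> card M" by simp
    with insert.IH[OF symT psdT] obtain a :: "'m \<Rightarrow> real^'n"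
      where a: "\<And>i j. T $ i $ j = (\<Sum>k\<in>M. a k $ i * a k $ j)" by blast
    \<comment> \<open>The factor \<open>1 / sqrt c\<close> makes the new square equal to the
      rank-one term subtracted from \<open>S\<close>.\<close>
    define b where "b = a(m := (1 / sqrt c) *\<^sub>R y)"
    have "S $ i $ j = (\<Sum>k\<in>insert m M. b k $ i * b k $ j)" for i j
    proof -
      have "(\<Sum>k\<in>M. b k $ i * b k $ j) = T $ i $ j"
        unfolding a using insert.hyps by (intro sum.cong) (auto simp: b_def)
      moreover have "b m $ i * b m $ j = y $ i * y $ j / c"
        using c by (simp add: b_def)
      ultimately show ?thesis using insert.hyps by (simp add: T_def)
    qed
    then show ?thesis by blast
  qed
qed

definition gram :: "('n::finite \<Rightarrow> 'a::real_inner) \<Rightarrow> real^'n^'n" where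
  "gram v = (\<chi> i j. v i \<bullet> v j)"

lemma transpose_gram: "transpose (gram v) = gram v"
  by (simp add: gram_def transpose_def vec_eq_iff inner_commute)

lemma quad_form_gram:
  "quad_form (gram v) l = (\<Sum>j\<in>UNIV. l $ j *\<^sub>R v j) \<bullet> (\<Sum>j\<in>UNIV. l $ j *\<^sub>R v j)"
  by (simp add: quad_form_def gram_def inner_sum_left inner_sum_right sum_distrib_left
      inner_commute ac_simps)

text \<open>Reading the coefficients the other way turns a sum of CARD('m) squares into vectors:
  coordinate m of the i-th vector is the i-th entry of \<open>a m\<close>.\<close>

lemma psd_imp_gram:
  fixes S :: "real^'n^'n"
  assumes "transpose S = S" "\<And>l. 0 \<le> quad_form S l" "rank S \<le> CARD('m::finite)"
  shows "\<exists>v :: 'n \<Rightarrow> real^'m. S = gram v"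
proof -
  obtain a :: "'m \<Rightarrow> real^'n" where "\<And>i j. S $ i $ j = (\<Sum>m\<in>UNIV. a m $ i * a m $ j)"
    using psd_sum_of_rank_one[of "UNIV :: 'm set" S] assms by auto
  then have "S = gram (\<lambda>i. \<chi> m. a m $ i)"
    by (simp add: gram_def vec_eq_iff inner_vec_def)
  then show ?thesis by blast
qed

text \<open>With the vectors as columns of \<open>A\<close>, the Gram matrix is
  \<open>transpose A ** A\<close>, so its rank is the column rank of \<open>A\<close>.\<close>

lemma rank_gram:
  fixes v :: "'n::finite \<Rightarrow> real^'m"
  shows "rank (gram v) = dim (range v)"
proof -
  define A where "A = (\<chi> m i. v i $ m)"
  have "gram v = transpose A ** A"
    by (simp add: A_def gram_def vec_eq_iff matrix_matrix_mult_def transpose_def inner_vec_def)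
  moreover have "columns A = range v"
    by (auto simp: columns_def column_def A_def)
  ultimately show ?thesis
    by (simp only: rank_transpose_mult_self column_rank_def[of A])
qed

section \<open>Quaternions as matrices\<close>

text \<open>The usual matrix of the quaternion x1 + x2 i + x3 j + x4 k; the second row is (-cnj b,
  cnj a) when the first is (a, b).\<close>

definition quat :: "real^4 \<Rightarrow> complex^2^2" where
  "quat x = vector [vector [Complex (x $ 1) (x $ 2), Complex (x $ 3) (x $ 4)],
                    vector [Complex (- x $ 3) (x $ 4), Complex (x $ 1) (- x $ 2)]]"

lemma quat_nth [simp]:
  "quat x $ 1 $ 1 = Complex (x $ 1) (x $ 2)" "quat x $ 1 $ 2 = Complex (x $ 3) (x $ 4)"
  "quat x $ 2 $ 1 = Complex (- x $ 3) (x $ 4)" "quat x $ 2 $ 2 = Complex (x $ 1) (- x $ 2)"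
  by (simp_all add: quat_def)

lemma linear_quat: "linear quat"
  by (rule linearI) (simp_all add: vec_eq_iff forall_2 complex_eq_iff)

lemma inj_quat: "inj quat"
  by (rule injI) (simp add: vec_eq_iff forall_2 forall_4 complex_eq_iff)

lemma inner_4:
  fixes x y :: "real^4"
  shows "x \<bullet> y = x $ 1 * y $ 1 + x $ 2 * y $ 2 + x $ 3 * y $ 3 + x $ 4 * y $ 4"
  by (simp add: inner_vec_def sum_4)

lemma det_quat: "det (quat x) = complex_of_real (x \<bullet> x)"
  by (simp add: det_2 inner_4 complex_eq_iff algebra_simps)

lemma quat_in_SU2_iff: "quat x \<in> SU2 \<longleftrightarrow> x \<bullet> x = 1"
proof
  assume "quat x \<in> SU2"
  then have "complex_of_real (x \<bullet> x) = 1" by (simp add: SU2_def flip: det_quat)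
  then show "x \<bullet> x = 1" by (simp only: of_real_eq_1_iff)
next
  assume "x \<bullet> x = 1"
  then show "quat x \<in> SU2"
    by (simp add: SU2_def det_quat)
       (simp add: inner_4 vec_eq_iff forall_2 matrix_matrix_mult_def conj_transpose_def sum_2
          mat_def complex_eq_iff algebra_simps)
qed

lemma SU2_imp_quat:
  assumes "A \<in> SU2"
  obtains x where "A = quat x"
proof
  show "A = quat (vector [Re (A $ 1 $ 1), Im (A $ 1 $ 1), Re (A $ 1 $ 2), Im (A $ 1 $ 2)])"
    using SU2_entries[OF assms]
    by (simp add: vec_eq_iff forall_2 complex_eq_iff vector_def)
qed

section \<open>Group structure of SU(2) and transposition\<close>

lemma mat_1_eq_quat: "mat 1 = quat (axis 1 1)"
  by (simp add: vec_eq_iff forall_2 mat_def axis_def complex_eq_iff)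

lemma mat_1_in_SU2: "mat 1 \<in> SU2"
  by (simp add: mat_1_eq_quat quat_in_SU2_iff inner_axis_axis)

lemma conj_transpose_mult:
  "conj_transpose (A ** B) = conj_transpose B ** conj_transpose (A :: complex^2^2)"
  by (simp add: vec_eq_iff conj_transpose_def matrix_matrix_mult_def sum_2 mult.commute)

lemma conj_transpose_conj_transpose [simp]: "conj_transpose (conj_transpose A) = A"
  by (simp add: vec_eq_iff conj_transpose_def)

lemma SU2_mult:
  assumes "A \<in> SU2" "B \<in> SU2"
  shows "A ** B \<in> SU2"
proof -
  have "conj_transpose (A ** B) ** (A ** B) = conj_transpose B ** (conj_transpose A ** A) ** B"
    "(A ** B) ** conj_transpose (A ** B) = A ** (B ** conj_transpose B) ** conj_transpose A"
    by (simp_all add: conj_transpose_mult matrix_mul_assoc)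
  with assms show ?thesis by (simp add: SU2_def det_mul)
qed

lemma SU2_conj_transpose:
  assumes "A \<in> SU2"
  shows "conj_transpose A \<in> SU2"
proof -
  have "det (conj_transpose A) = cnj (det A)"
    by (simp add: det_2 conj_transpose_def)
  with assms show ?thesis by (simp add: SU2_def)
qed

text \<open>In quaternion coordinates transposition only flips the sign of the j-coordinate, so it
  preserves the norm.\<close>

lemma SU2_transpose:
  assumes "A \<in> SU2"
  shows "transpose A \<in> SU2"
proof -
  obtain x where x: "A = quat x" using SU2_imp_quat[OF assms] .
  have "transpose A = quat (vector [x $ 1, x $ 2, - x $ 3, x $ 4])"
    by (simp add: x vec_eq_iff forall_2 transpose_def vector_def)
  with assms show ?thesis
    by (simp add: x quat_in_SU2_iff inner_4 vector_def)
qed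

lemma linear_matrix_sandwich:
  fixes h q :: "complex^2^2"
  shows "linear (\<lambda>X. h ** X ** q)"
  by (rule linearI)
     (simp_all add: vec_eq_iff matrix_matrix_mult_def sum_2 distrib_left distrib_right
       scaleR_add_right)

lemma linear_transpose: "linear (transpose :: complex^2^2 \<Rightarrow> complex^2^2)"
  by (rule linearI) (simp_all add: vec_eq_iff transpose_def)

section \<open>Orthogonal maps of the quaternions\<close>

text \<open>These are the orthogonal maps of R^4: the first alternative gives the rotations, the
  second the maps of determinant -1.\<close>

definition sandwich :: "(real^4 \<Rightarrow> real^4) \<Rightarrow> bool" where
  "sandwich f \<longleftrightarrow> (\<exists>h\<in>SU2. \<exists>q\<in>SU2. (\<forall>x. quat (f x) = h ** quat x ** q) \<or>
                                   (\<forall>x. quat (f x) = h ** transpose (quat x) ** q))"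

text \<open>The reflection is \<open>x \<mapsto> - u x\<^sup>* u\<close>, and the adjugate \<open>x\<^sup>*\<close> of a \<open>2 \<times> 2\<close> matrix is
  \<open>- J x\<^sup>t J\<close> for \<open>J = quat (axis 3 1)\<close>.\<close>
lemma quat_reflection:
  assumes "u \<bullet> u = 1"
  shows "quat (x - (2 * (x \<bullet> u)) *\<^sub>R u)
       = (quat u ** quat (axis 3 1)) ** transpose (quat x) ** (quat (axis 3 1) ** quat u)"
proof -
  have "quat ((u \<bullet> u) *\<^sub>R x - (2 * (x \<bullet> u)) *\<^sub>R u)
       = (quat u ** quat (axis 3 1)) ** transpose (quat x) ** (quat (axis 3 1) ** quat u)"
    by (simp add: vec_eq_iff forall_2 matrix_matrix_mult_def sum_2 transpose_def axis_def
        complex_eq_iff inner_4) (simp add: algebra_simps)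
  with assms show ?thesis by simp
qed

lemma sandwich_id: "sandwich (\<lambda>x. x)"
  unfolding sandwich_def
  by (rule bexI[OF _ mat_1_in_SU2], rule bexI[OF _ mat_1_in_SU2]) simp

text \<open>A reflection transposes its argument, and transposing a product reverses it. So the two
  alternatives are exchanged, and \<open>h\<close> and \<open>q\<close> change sides in transposed
  form.\<close>

lemma sandwich_reflection:
  assumes f: "sandwich f" and u: "u \<bullet> u = 1"
  shows "sandwich (\<lambda>x. f x - (2 * (f x \<bullet> u)) *\<^sub>R u)"
proof -
  let ?J = "quat (axis 3 1)"
  have J: "?J \<in> SU2" "quat u \<in> SU2" by (simp_all add: quat_in_SU2_iff inner_axis_axis u)
  obtain h q where hq: "h \<in> SU2" "q \<in> SU2"
    and or: "(\<forall>x. quat (f x) = h ** quat x ** q) \<or> (\<forall>x. quat (f x) = h ** transpose (quat x) ** q)"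
    using f unfolding sandwich_def by blast
  let ?h = "quat u ** ?J ** transpose q" and ?q = "transpose h ** ?J ** quat u"
  have "?h \<in> SU2" "?q \<in> SU2"
    using hq J by (simp_all add: SU2_mult SU2_transpose)
  moreover have "(\<forall>x. quat (f x - (2 * (f x \<bullet> u)) *\<^sub>R u) = ?h ** quat x ** ?q) \<or>
      (\<forall>x. quat (f x - (2 * (f x \<bullet> u)) *\<^sub>R u) = ?h ** transpose (quat x) ** ?q)"
    using or by (auto simp: quat_reflection[OF u] matrix_transpose_mul matrix_mul_assoc)
  ultimately show ?thesis unfolding sandwich_def by blast
qed

text \<open>Both outer factors have determinant 1 and the determinant is the squared norm, so norms
  are preserved. Additivity of \<open>f\<close> follows from injectivity of \<open>quat\<close>, and
  polarization then gives inner products.\<close>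

lemma sandwich_inner:
  assumes "sandwich f"
  shows "f x \<bullet> f y = x \<bullet> y"
proof -
  obtain h q where hq: "h \<in> SU2" "q \<in> SU2"
    and or: "(\<forall>x. quat (f x) = h ** quat x ** q) \<or> (\<forall>x. quat (f x) = h ** transpose (quat x) ** q)"
    using assms unfolding sandwich_def by blast
  have "det (quat (f x)) = det (quat x)" for x
    using or hq by (auto simp: det_mul det_transpose SU2_def)
  then have sq: "f x \<bullet> f x = x \<bullet> x" for x
    by (simp only: det_quat of_real_eq_iff)
  have "linear (\<lambda>x. h ** quat x ** q)" "linear (\<lambda>x. h ** transpose (quat x) ** q)"
    using linear_compose[OF linear_quat linear_matrix_sandwich[of h q]]
      linear_compose[OF linear_compose[OF linear_quat linear_transpose] linear_matrix_sandwich[of h q]]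
    by (simp_all add: o_def)
  then have "linear (quat \<circ> f)"
    using or by (auto simp: o_def)
  then have "quat (f (x + y)) = quat (f x + f y)"
    using linear_add[OF linear_quat] linear_add by fastforce
  then have add: "f (x + y) = f x + f y"
    using inj_quat by (simp add: inj_eq)
  show ?thesis
    using sq[of "x + y"] sq[of x] sq[of y] unfolding add
    by (simp add: inner_add_left inner_add_right inner_commute)
qed

text \<open>If \<open>f\<close> already matches the first vectors, the reflection swapping \<open>f (v k)\<close> and \<open>w k\<close>
  fixes all of them, because the two Gram matrices agree.\<close>
lemma gram_eq_imp_sandwich:
  fixes v w :: "'n::finite \<Rightarrow> real^4"
  assumes "gram v = gram w"
  shows "\<exists>f. sandwich f \<and> (\<forall>j. f (v j) = w j)"
proof -
  have vw: "v i \<bullet> v j = w i \<bullet> w j" for i j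
    using assms by (simp add: gram_def vec_eq_iff)
  have "\<exists>f. sandwich f \<and> (\<forall>j\<in>J. f (v j) = w j)" for J
    using finite[of J]
  proof (induction J rule: finite_induct)
    case empty
    then show ?case using sandwich_id by auto
  next
    case (insert k J)
    then obtain f where f: "sandwich f" and fw: "\<And>j. j \<in> J \<Longrightarrow> f (v j) = w j" by blast
    show ?case
    proof (cases "f (v k) = w k")
      case True
      with f fw show ?thesis by auto
    next
      case False
      define d where "d = f (v k) - w k"
      define u where "u = d /\<^sub>R norm d"
      have d: "norm d \<noteq> 0" using False by (simp add: d_def)
      then have u: "u \<bullet> u = 1"
        by (simp add: u_def dot_square_norm power2_eq_square)
      define r where "r = (\<lambda>x. x - (2 * (x \<bullet> u)) *\<^sub>R u)"
      have "(2 * (x \<bullet> u)) *\<^sub>R u = (2 * (x \<bullet> d) / (d \<bullet> d)) *\<^sub>R d" for x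
        by (simp add: u_def dot_square_norm power2_eq_square divide_inverse)
      then have r: "r x = x - (2 * (x \<bullet> d) / (d \<bullet> d)) *\<^sub>R d" for x
        by (simp add: r_def)
      have nn: "f (v k) \<bullet> f (v k) = w k \<bullet> w k"
        by (simp add: sandwich_inner[OF f] vw)
      \<comment> \<open>Since \<open>f (v k)\<close> and \<open>w k\<close> have equal norms, the
        coefficient of \<open>d\<close> in \<open>r (f (v k))\<close> is 1, so \<open>r\<close>
        subtracts exactly \<open>d\<close>.\<close>
      have "d \<bullet> d = 2 * (f (v k) \<bullet> d)"
        using nn by (simp add: d_def inner_diff_left inner_diff_right inner_commute)
      then have "r (f (v k)) = w k"
        using d by (auto simp: r) (simp add: d_def)
      moreover have "r (w j) = w j" if "j \<in> J" for j
      proof -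
        have "w j \<bullet> d = 0"
          using fw[OF that] sandwich_inner[OF f, of "v j" "v k"]
          by (simp add: d_def inner_diff_right vw)
        then show ?thesis by (simp add: r)
      qed
      moreover have "sandwich (\<lambda>x. r (f x))"
        unfolding r_def by (rule sandwich_reflection[OF f u])
      ultimately show ?thesis
        using fw by (intro exI[of _ "\<lambda>x. r (f x)"]) auto
    qed
  qed
  from this[of UNIV] show ?thesis by simp
qed

text \<open>Otherwise transposition would be both a homomorphism and an antihomomorphism.\<close>
lemma transpose_not_sandwich:
  assumes "\<And>x. h ** quat x ** q = transpose (quat x)"
  shows False
proof -
  \<comment> \<open>The value at the identity shows that the sandwich is a conjugation, hence
    multiplicative.\<close>
  have "h ** q = mat 1"
    using assms[of "axis 1 1"] by (simp add: transpose_mat flip: mat_1_eq_quat)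
  then have qh: "q ** h = mat 1" by (simp add: matrix_left_right_inverse)
  \<comment> \<open>These are j and i. Here ji = -k, while the product of the transposes is (-j)i =
    k. Multiplicativity would make k the transpose of -k, but transposition fixes -k.\<close>
  let ?x = "quat (axis 3 1)" and ?y = "quat (axis 2 1)"
  have xy: "?x ** ?y = quat (- axis 4 1)" "transpose ?x ** transpose ?y = quat (axis 4 1)"
    by (simp_all add: vec_eq_iff forall_2 matrix_matrix_mult_def sum_2 transpose_def axis_def
        complex_eq_iff)
  have "transpose ?x ** transpose ?y = h ** ?x ** (q ** h) ** ?y ** q"
    by (simp only: assms[symmetric] matrix_mul_assoc)
  also have "\<dots> = h ** (?x ** ?y) ** q"
    by (simp only: qh matrix_mul_rid matrix_mul_assoc)
  also have "\<dots> = transpose (quat (- axis 4 1))"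
    by (simp only: xy assms)
  finally have "quat (axis 4 1) = transpose (quat (- axis 4 1))"
    by (simp only: xy)
  then show False
    by (simp add: vec_eq_iff forall_2 transpose_def axis_def complex_eq_iff)
qed

section \<open>Tuples and double cosets\<close>

lemma G_iff_quat: "g \<in> G \<longleftrightarrow> (\<exists>v. g = (\<lambda>j. quat (v j)) \<and> (\<forall>j. v j \<bullet> v j = 1))"
proof
  assume g: "g \<in> G"
  then have "\<forall>j. \<exists>x. g j = quat x" unfolding G_def using SU2_imp_quat by blast
  then obtain v where v: "\<And>j. g j = quat (v j)" by metis
  with g show "\<exists>v. g = (\<lambda>j. quat (v j)) \<and> (\<forall>j. v j \<bullet> v j = 1)"
    by (intro exI[of _ v]) (auto simp: G_def fun_eq_iff simp flip: quat_in_SU2_iff)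
qed (auto simp: G_def quat_in_SU2_iff)

text \<open>\<open>quat\<close> is linear, so the determinant of the combination is the squared norm
  of the same combination of the vectors.\<close>

lemma spectral_form_quat: "spectral_form (\<lambda>j. quat (v j)) = quad_form (gram v)"
proof
  fix l
  have "(\<Sum>j\<in>UNIV. l $ j *\<^sub>R quat (v j)) = quat (\<Sum>j\<in>UNIV. l $ j *\<^sub>R v j)"
    by (simp add: linear_sum[OF linear_quat] linear_scale[OF linear_quat])
  then show "spectral_form (\<lambda>j. quat (v j)) l = quad_form (gram v) l"
    by (simp only: spectral_form_def quad_form_gram det_quat Re_complex_of_real)
qed

lemma form_rank_quat: "form_rank (spectral_form (\<lambda>j. quat (v j))) = dim (range v)"
  by (simp add: form_rank_def spectral_form_quat form_matrix_quad_form transpose_gram rank_gram)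

text \<open>Surjectivity at the level of tuples. The bound 4 is the dimension of the quaternions: it
  bounds the rank of a Gram matrix there and suffices to realize \<open>S\<close> by vectors there.
  The diagonal condition says that these are unit vectors.\<close>

lemma spectral_form_image: "spectral_form ` G = (Xi :: (real^'n \<Rightarrow> real) set)"
proof (intro equalityI subsetI)
  fix Q :: "real^'n \<Rightarrow> real" assume "Q \<in> spectral_form ` G"
  then obtain v :: "'n \<Rightarrow> real^4" where Q: "Q = spectral_form (\<lambda>j. quat (v j))"
    and v: "\<forall>j. v j \<bullet> v j = 1"
    by (auto simp: G_iff_quat)
  have "form_rank Q \<le> 4"
    unfolding Q form_rank_quat using dim_subset_UNIV[of "range v"] by simp
  with v show "Q \<in> Xi"
    unfolding Xi_def
    by (auto intro!: exI[of _ "gram v"] transpose_gram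
        simp: Q spectral_form_quat quad_form_gram) (simp add: gram_def)
next
  fix Q :: "real^'n \<Rightarrow> real" assume "Q \<in> Xi"
  then obtain S where S: "transpose S = S" "Q = quad_form S" "\<And>l. 0 \<le> Q l" "form_rank Q \<le> 4"
    "\<And>j. S $ j $ j = 1"
    by (auto simp: Xi_def)
  then have "rank S \<le> CARD(4)" by (simp add: form_rank_def form_matrix_quad_form)
  then obtain v :: "'n \<Rightarrow> real^4" where v: "S = gram v" using psd_imp_gram[of S] S by blast
  then have "v j \<bullet> v j = 1" for j using S(5)[of j] by (simp add: gram_def)
  then have "(\<lambda>j. quat (v j)) \<in> G" by (auto simp: G_iff_quat)
  moreover have "Q = spectral_form (\<lambda>j. quat (v j))" using S v by (simp add: spectral_form_quat)
  ultimately show "Q \<in> spectral_form ` G" by blast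
qed

section \<open>Double cosets as equivalence classes\<close>

lemma dc_relI:
  assumes "g \<in> G" "g' \<in> G" "h \<in> SU2" "q \<in> SU2" "\<And>j. g' j = h ** g j ** q"
  shows "(g, g') \<in> dc_rel"
  using assms unfolding dc_rel_def by blast

lemma equiv_dc_rel: "equiv (G :: ('n::finite \<Rightarrow> complex^2^2) set) dc_rel"
proof (rule equivI)
  show "dc_rel \<subseteq> (G :: ('n \<Rightarrow> complex^2^2) set) \<times> G" by (auto simp: dc_rel_def)
  show "refl_on (G :: ('n \<Rightarrow> complex^2^2) set) dc_rel"
    by (rule refl_onI) (rule dc_relI[OF _ _ mat_1_in_SU2 mat_1_in_SU2], auto)
  show "sym (dc_rel :: (('n \<Rightarrow> complex^2^2) \<times> _) set)"
  proof (rule symI)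
    fix g g' :: "'n \<Rightarrow> complex^2^2" assume "(g, g') \<in> dc_rel"
    then obtain h q where G: "g \<in> G" "g' \<in> G" and hq: "h \<in> SU2" "q \<in> SU2"
      and g': "\<And>j. g' j = h ** g j ** q"
      unfolding dc_rel_def by blast
    have "conj_transpose h ** g' j ** conj_transpose q
        = (conj_transpose h ** h) ** g j ** (q ** conj_transpose q)" for j
      by (simp add: g' matrix_mul_assoc)
    with hq have inv: "g j = conj_transpose h ** g' j ** conj_transpose q" for j
      by (simp add: SU2_def)
    show "(g', g) \<in> dc_rel"
      by (rule dc_relI[OF G(2,1) SU2_conj_transpose[OF hq(1)] SU2_conj_transpose[OF hq(2)] inv])
  qed
  show "trans (dc_rel :: (('n \<Rightarrow> complex^2^2) \<times> _) set)"
  proof (rule transI)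
    fix g g' g'' :: "'n \<Rightarrow> complex^2^2" assume "(g, g') \<in> dc_rel" "(g', g'') \<in> dc_rel"
    then obtain h q k r where G: "g \<in> G" "g'' \<in> G"
      and hq: "h \<in> SU2" "q \<in> SU2" "k \<in> SU2" "r \<in> SU2"
      and eqs: "\<And>j. g' j = h ** g j ** q" "\<And>j. g'' j = k ** g' j ** r"
      unfolding dc_rel_def by blast
    show "(g, g'') \<in> dc_rel"
      by (rule dc_relI[OF G SU2_mult[OF hq(3,1)] SU2_mult[OF hq(2,4)]])
        (simp add: eqs matrix_mul_assoc)
  qed
qed

lemma dc_class_eq_iff:
  assumes "g \<in> G" "g' \<in> G"
  shows "dc_class g = dc_class g' \<longleftrightarrow> (g, g') \<in> dc_rel"
  unfolding dc_class_def using eq_equiv_class_iff[OF equiv_dc_rel assms] .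

lemma Pi_dc_eq: "Pi_dc = dc_class ` G"
  by (auto simp: Pi_dc_def quotient_def dc_class_def)

section \<open>Fibres of the spectral form and the transposed tuple\<close>

lemma transpose_in_G: "g \<in> G \<Longrightarrow> (\<lambda>j. transpose (g j)) \<in> G"
  by (simp add: G_def SU2_transpose)

text \<open>Puts the transposed tuple in the same fibre as \<open>g\<close>: transposition is linear
  and preserves determinants.\<close>

lemma spectral_form_transpose: "spectral_form (\<lambda>j. transpose (g j)) = spectral_form g"
proof
  fix l
  have "(\<Sum>j\<in>UNIV. l $ j *\<^sub>R transpose (g j)) = transpose (\<Sum>j\<in>UNIV. l $ j *\<^sub>R g j)"
    by (simp only: linear_sum[OF linear_transpose] linear_scale[OF linear_transpose])
  then show "spectral_form (\<lambda>j. transpose (g j)) l = spectral_form g l"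
    by (simp only: spectral_form_def det_transpose)
qed

text \<open>A form determines its symmetric matrix, so the Gram matrices agree and some
  \<open>sandwich\<close> map carries one tuple to the other. Its two alternatives give the two
  possible classes.\<close>

lemma spectral_form_eq_imp_dc_class:
  fixes g g' :: "'n::finite \<Rightarrow> complex^2^2"
  assumes G: "g \<in> G" "g' \<in> G" and eq: "spectral_form g = spectral_form g'"
  shows "dc_class g' = dc_class g \<or> dc_class g' = dc_class (\<lambda>j. transpose (g j))"
proof -
  obtain v w where v: "g = (\<lambda>j. quat (v j))" and w: "g' = (\<lambda>j. quat (w j))"
    using G by (auto simp: G_iff_quat)
  have "gram v = gram w"
    using eq unfolding v w spectral_form_quat
    by (metis form_matrix_quad_form transpose_gram)
  then obtain f where f: "sandwich f" and fw: "\<And>j. f (v j) = w j"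
    using gram_eq_imp_sandwich by blast
  then obtain h q where hq: "h \<in> SU2" "q \<in> SU2"
    and or: "(\<forall>x. quat (f x) = h ** quat x ** q) \<or> (\<forall>x. quat (f x) = h ** transpose (quat x) ** q)"
    unfolding sandwich_def by blast
  from or have "(g, g') \<in> dc_rel \<or> ((\<lambda>j. transpose (g j)), g') \<in> dc_rel"
  proof
    assume "\<forall>x. quat (f x) = h ** quat x ** q"
    then have "(g, g') \<in> dc_rel"
      by (intro dc_relI[OF G hq]) (simp add: v w flip: fw)
    then show ?thesis ..
  next
    assume "\<forall>x. quat (f x) = h ** transpose (quat x) ** q"
    then have "((\<lambda>j. transpose (g j)), g') \<in> dc_rel"
      by (intro dc_relI[OF transpose_in_G[OF G(1)] G(2) hq]) (simp add: v w flip: fw)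
    then show ?thesis ..
  qed
  then show ?thesis
    using dc_class_eq_iff G transpose_in_G by metis
qed

text \<open>Equality of the classes gives a sandwich agreeing with transposition on the tuple, and
  by linearity on its span, which cannot be everything. Conversely, a tuple that does not span is
  fixed by a reflection, which is a sandwich of the transpose.\<close>

lemma dc_class_transpose_iff:
  fixes g :: "'n::finite \<Rightarrow> complex^2^2"
  assumes g: "g \<in> G"
  shows "dc_class (\<lambda>j. transpose (g j)) = dc_class g \<longleftrightarrow> form_rank (spectral_form g) \<le> 3"
proof -
  obtain v where v: "g = (\<lambda>j. quat (v j))" using g by (auto simp: G_iff_quat)
  have fr: "form_rank (spectral_form g) = dim (range v)" by (simp add: v form_rank_quat)
  show ?thesis
  proof
    assume "dc_class (\<lambda>j. transpose (g j)) = dc_class g"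
    then have "(g, (\<lambda>j. transpose (g j))) \<in> dc_rel"
      using dc_class_eq_iff[OF g transpose_in_G[OF g]] by simp
    then obtain h q where hq: "\<And>j. transpose (g j) = h ** g j ** q"
      unfolding dc_rel_def by blast
    show "form_rank (spectral_form g) \<le> 3"
    proof (rule ccontr)
      assume "\<not> ?thesis"
      then have "dim (range v) = DIM(real^4)"
        using dim_subset_UNIV[of "range v"] by (simp add: fr)
      then have span: "span (range v) = UNIV" by (simp only: dim_eq_full)
      have lin: "linear (\<lambda>x. h ** quat x ** q)" "linear (\<lambda>x. transpose (quat x))"
        using linear_compose[OF linear_quat linear_matrix_sandwich[of h q]]
          linear_compose[OF linear_quat linear_transpose] by (simp_all add: o_def)
      have "h ** quat x ** q = transpose (quat x)" for x
      proof (rule linear_eq_on_span[OF lin, of "range v"])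
        show "x \<in> span (range v)" by (simp add: span)
      qed (use hq in \<open>auto simp: v\<close>)
      then show False by (rule transpose_not_sandwich)
    qed
  next
    assume "form_rank (spectral_form g) \<le> 3"
    then have "dim (range v) < DIM(real^4)" by (simp add: fr)
    then obtain d where d: "d \<noteq> 0" "\<And>y. y \<in> span (range v) \<Longrightarrow> orthogonal d y"
      by (rule orthogonal_to_subspace_exists) auto
    define u where "u = d /\<^sub>R norm d"
    have u: "u \<bullet> u = 1" using d(1) by (simp add: u_def dot_square_norm power2_eq_square)
    have "v j \<bullet> u = 0" for j
      using d(2)[of "v j"] by (simp add: u_def span_base orthogonal_def inner_commute)
    \<comment> \<open>The reflection in \<open>u\<close> fixes \<open>v j\<close>, so its matrix
      formula returns \<open>g j\<close>.\<close>
    then have refl: "g j = (quat u ** quat (axis 3 1)) ** transpose (g j) ** (quat (axis 3 1) ** quat u)" for j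
      using quat_reflection[OF u, of "v j"] by (simp add: v)
    have J: "quat u \<in> SU2" "quat (axis 3 1) \<in> SU2"
      by (simp_all add: quat_in_SU2_iff u inner_axis_axis)
    have "((\<lambda>j. transpose (g j)), g) \<in> dc_rel"
      by (rule dc_relI[OF transpose_in_G[OF g] g SU2_mult[OF J] SU2_mult[OF J(2,1)] refl])
    then show "dc_class (\<lambda>j. transpose (g j)) = dc_class g"
      using dc_class_eq_iff[OF transpose_in_G[OF g] g] by simp
  qed
qed

theorem theorem2p2:
  shows "(zeta :: ('n::finite \<Rightarrow> complex^2^2) set \<Rightarrow> (real^'n \<Rightarrow> real)) ` Pi_dc = Xi
    \<and> (\<forall>Q \<in> (Xi :: (real^'n \<Rightarrow> real) set).
           (form_rank Q = 4 \<longrightarrow> card {p \<in> Pi_dc. zeta p = Q} = 2) \<and>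
           (form_rank Q \<le> 3 \<longrightarrow> card {p \<in> Pi_dc. zeta p = Q} = 1))
    \<and> (\<forall>g \<in> (G :: ('n \<Rightarrow> complex^2^2) set).
           form_rank (spectral_form g) \<le> 3 \<longleftrightarrow>
           dc_class (\<lambda>j. transpose (g j)) = dc_class g)"
proof (intro conjI ballI)
  show "(zeta :: ('n \<Rightarrow> complex^2^2) set \<Rightarrow> (real^'n \<Rightarrow> real)) ` Pi_dc = Xi"
    \<comment> \<open>Both sides are images of \<open>G\<close>, because \<open>zeta\<close>
      composed with \<open>dc_class\<close> is the spectral form.\<close>
    unfolding Pi_dc_eq image_image spectral_form_image[symmetric]
    by (rule image_cong) (simp_all add: zeta_dc_class)
next
  fix Q :: "real^'n \<Rightarrow> real" assume "Q \<in> Xi"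
  then obtain g where g: "g \<in> G" and Q: "Q = spectral_form g"
    unfolding spectral_form_image[symmetric] by blast
  have fibre: "{p \<in> Pi_dc. zeta p = Q} = {dc_class g, dc_class (\<lambda>j. transpose (g j))}"
  proof (intro equalityI subsetI)
    fix p assume "p \<in> {p \<in> Pi_dc. zeta p = Q}"
    then obtain g' where g': "g' \<in> G" "p = dc_class g'" "zeta p = Q"
      unfolding Pi_dc_eq by blast
    then have "spectral_form g = spectral_form g'"
      using Q by (simp add: zeta_dc_class)
    from spectral_form_eq_imp_dc_class[OF g g'(1) this]
    show "p \<in> {dc_class g, dc_class (\<lambda>j. transpose (g j))}" using g'(2) by simp
  next
    fix p assume "p \<in> {dc_class g, dc_class (\<lambda>j. transpose (g j))}"
    then show "p \<in> {p \<in> Pi_dc. zeta p = Q}"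
      using g transpose_in_G[OF g]
      by (auto simp: Pi_dc_eq zeta_dc_class Q spectral_form_transpose)
  qed
  show "form_rank Q = 4 \<longrightarrow> card {p \<in> Pi_dc. zeta p = Q} = 2"
    "form_rank Q \<le> 3 \<longrightarrow> card {p \<in> Pi_dc. zeta p = Q} = 1"
    \<comment> \<open>The fibre is an explicit pair; the rank decides whether its two members
      coincide.\<close>
    unfolding fibre using dc_class_transpose_iff[OF g]
    by (auto simp: Q card_insert_if simp del: insert_iff)
next
  fix g :: "'n \<Rightarrow> complex^2^2" assume "g \<in> G"
  then show "form_rank (spectral_form g) \<le> 3 \<longleftrightarrow>
      dc_class (\<lambda>j. transpose (g j)) = dc_class g"
    by (rule dc_class_transpose_iff[symmetric])
qed

end
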